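(* Let $A\subseteq\mathbb{R}$ be an open invex subset with respect to $\eta:A\times A\to\mathbb{R}$, and let $a,b\in A$ with $a<a+\eta(b,a)$. If $f:[a,a+\eta(b,a)]\to(0,\infty)$ is a prequasiinvex function (with respect to $\eta$), $f\in L[a,a+\eta(b,a)]$, and $\eta$ satisfies Condition C, then for $\alpha>0$ the following inequalities for fractional integrals hold: $$\frac{\Gamma(\alpha+1)}{2\,\eta(b,a)^{\alpha}}\left[J_{a^{+}}^{\alpha}f\big(a+\eta(b,a)\big)+J_{(a+\eta(b,a))^{-}}^{\alpha}f(a)\right]\le \max\{f(a),f(a+\eta(b,a))\}\le\max\{f(a),f(b)\}.$$
   Context: A set $S\subseteq\mathbb{R}$ is invex with respect to $\eta$ if $x+t\eta(y,x)\in S$ for all $x,y\in S$ and $t\in[0,1]$. A function $g$ on an invex set $S$ is prequasiinvex with respect to $\eta$ if $g(x+t\eta(y,x))\le\max\{g(x),g(y)\}$ for all $x,y\in S$ and $t\in[0,1]$. Condition C on $\eta$: for all $x,y\in A$ and $t\in[0,1]$, $$\eta(y,y+t\eta(x,y))=-t\,\eta(x,y),\qquad \eta(x,y+t\eta(x,y))=(1-t)\,\eta(x,y).$$ It has the consequence $\eta(y+t_2\eta(x,y),\,y+t_1\eta(x,y))=(t_2-t_1)\eta(x,y)$ for $t_1,t_2\in[0,1]$, so the interval $[a,a+\eta(b,a)]$ is itself invex with respect to $\eta$. $L[c,d]$ denotes the integrable functions on $[c,d]$. For $f\in L[c,d]$ and $\alpha>0$ the Riemann–Liouville fractional integrals are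 $$J_{c^{+}}^{\alpha}f(x)=\frac{1}{\Gamma(\alpha)}\int_c^x (x-t)^{\alpha-1}f(t)\,dt\ (x>c),\qquad J_{d^{-}}^{\alpha}f(x)=\frac{1}{\Gamma(\alpha)}\int_x^d (t-x)^{\alpha-1}f(t)\,dt\ (x<d),$$ where $\Gamma$ is the Gamma function. Here they are used with $c=a$ and $d=a+\eta(b,a)$. The last term of the chain contains $f(b)$, which is meaningful only when $b$ lies in the domain of $f$.
   Formalization: f(b) is undefined when b lies outside [a,a+η(b,a)], so the last inequality is stated for b in an invex set D ⊆ A that contains this interval and on which f is prequasiinvex (D may be the interval itself); the first inequality holds as written. *)

theory Defs
  imports "HOL-Analysis.Analysis"
begin

(* A map eta : A x A -> R is a total function here; the definitions below only evaluate it
   (and the function g) at points of the given set, provided that set is invex. *)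

definition invex :: "real set \<Rightarrow> (real \<Rightarrow> real \<Rightarrow> real) \<Rightarrow> bool" where
  "invex S \<eta> \<longleftrightarrow> (\<forall>x\<in>S. \<forall>y\<in>S. \<forall>t\<in>{0..1}. x + t * \<eta> y x \<in> S)"

(* To be used for invex S only. Invexity is not part of the definition, so that assuming
   prequasiinvexity does not silently assume it. *)
definition prequasiinvex_on ::
    "real set \<Rightarrow> (real \<Rightarrow> real \<Rightarrow> real) \<Rightarrow> (real \<Rightarrow> real) \<Rightarrow> bool" where
  "prequasiinvex_on S \<eta> g \<longleftrightarrow>
     (\<forall>x\<in>S. \<forall>y\<in>S. \<forall>t\<in>{0..1}. g (x + t * \<eta> y x) \<le> max (g x) (g y))"

definition condition_C :: "real set \<Rightarrow> (real \<Rightarrow> real \<Rightarrow> real) \<Rightarrow> bool" where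
  "condition_C A \<eta> \<longleftrightarrow> (\<forall>x\<in>A. \<forall>y\<in>A. \<forall>t\<in>{0..1}.
     \<eta> y (y + t * \<eta> x y) = - t * \<eta> x y \<and>
     \<eta> x (y + t * \<eta> x y) = (1 - t) * \<eta> x y)"

(* The integrals are Lebesgue integrals. With powr the kernel is 0 at the endpoint t = x
   for every exponent; this is a null set. *)

definition RL_left :: "real \<Rightarrow> real \<Rightarrow> (real \<Rightarrow> real) \<Rightarrow> real \<Rightarrow> real" where
  "RL_left c \<alpha> f x =
     1 / Gamma \<alpha> * (LINT t:{c..x}|lebesgue. (x - t) powr (\<alpha> - 1) * f t)"

definition RL_right :: "real \<Rightarrow> real \<Rightarrow> (real \<Rightarrow> real) \<Rightarrow> real \<Rightarrow> real" where
  "RL_right d \<alpha> f x =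
     1 / Gamma \<alpha> * (LINT t:{x..d}|lebesgue. (t - x) powr (\<alpha> - 1) * f t)"

lemma condition_C_diff:
  assumes inv: "invex A \<eta>" and C: "condition_C A \<eta>" and xy: "x \<in> A" "y \<in> A"
    and s: "s \<in> {0..1}" and t: "t \<in> {0..1}"
  shows "\<eta> (y + s * \<eta> x y) (y + t * \<eta> x y) = (s - t) * \<eta> x y"
proof -
  define e where "e = \<eta> x y"
  have mem: "y + r * e \<in> A" if "r \<in> {0..1}" for r
    using inv xy that unfolding invex_def e_def by blast
  have C1: "\<eta> v (v + r * \<eta> u v) = - r * \<eta> u v"
    and C2: "\<eta> u (v + r * \<eta> u v) = (1 - r) * \<eta> u v"
    if "u \<in> A" "v \<in> A" "r \<in> {0..1}" for u v r
    using C that unfolding condition_C_def by blast+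
  have fwd: "\<eta> (y + s * e) (y + t * e) = (s - t) * e"
    if st: "s \<in> {0..1}" "t \<in> {0..1}" "t \<le> s" for s t
  proof (cases "s = 0")
    case True
    then have "t = 0" using st by auto
    then show ?thesis using True C1[of x y 0] xy by (simp add: e_def)
  next
    case False
    then have s0: "s > 0" using st by auto
    have y_s: "\<eta> y (y + s * e) = - s * e" using C1[of x y s] xy st by (simp add: e_def)
    have "\<eta> (y + s * e) y = s * e"
      using C1[of y "y + s * e" 1] mem[of s] xy st y_s by simp
    then have "\<eta> (y + s * e) (y + t / s * (s * e)) = (1 - t / s) * (s * e)"
      using C2[of "y + s * e" y "t / s"] mem[of s] xy st s0 by simp
    moreover have "t / s * (s * e) = t * e" and "(1 - t / s) * (s * e) = (s - t) * e"
      using s0 by (simp_all add: algebra_simps)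
    ultimately show ?thesis by simp
  qed
  have "\<eta> (y + s * e) (y + t * e) = (s - t) * e"
  proof (cases "t \<le> s")
    case True
    then show ?thesis using fwd s t by blast
  next
    case False
    then have ts: "\<eta> (y + t * e) (y + s * e) = (t - s) * e" using fwd s t by simp
    then show ?thesis
      using C1[of "y + t * e" "y + s * e" 1] mem[OF s] mem[OF t]
      by (simp add: algebra_simps)
  qed
  then show ?thesis by (simp add: e_def)
qed

lemma invex_interval:
  assumes inv: "invex A \<eta>" and C: "condition_C A \<eta>" and ab: "a \<in> A" "b \<in> A"
    and pos: "a < a + \<eta> b a"
  shows "invex {a..a + \<eta> b a} \<eta>"
  unfolding invex_def
proof (intro ballI)
  fix x y t :: real
  assume x: "x \<in> {a..a + \<eta> b a}" and y: "y \<in> {a..a + \<eta> b a}" and t: "t \<in> {0..1}"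
  define p where "p = (x - a) / \<eta> b a"
  define q where "q = (y - a) / \<eta> b a"
  have p: "p \<in> {0..1}" "x = a + p * \<eta> b a" and q: "q \<in> {0..1}" "y = a + q * \<eta> b a"
    using x y pos by (auto simp: p_def q_def field_simps)
  have "\<eta> y x = y - x"
    using condition_C_diff[OF inv C ab(2,1) q(1) p(1)] p(2) q(2) by (simp add: algebra_simps)
  then have "x + t * \<eta> y x = x + t * (y - x)" by simp
  also have "\<dots> = (1 - t) * x + t * y" by (simp add: algebra_simps)
  also have "\<dots> \<in> {a..a + \<eta> b a}"
    using convexD[OF convex_real_interval(5) x y, of "1 - t" t] t by simp
  finally show "x + t * \<eta> y x \<in> {a..a + \<eta> b a}" .
qed

end

theory Submission imports Defs begin

text \<open>
  Condition C gives \<^term>\<open>\<eta> (a + \<eta> b a) a = \<eta> b a\<close>, so prequasiinvexity between the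
  two endpoints of the interval bounds \<open>f\<close> by their maximum on the whole interval. Each fractional
  integral of a constant \<open>M\<close> over the interval equals \<open>M * \<eta> b a powr \<alpha> / \<Gamma>(\<alpha> + 1)\<close>.
\<close>

text \<open>For \<alpha> < 1 the kernel is unbounded near t = d. Since \<alpha> > 0, the
  antiderivative is still continuous up to d, so the form of the fundamental theorem that asks for a
  derivative only in the interior applies. The kernel of the other integral is the mirror
  image.\<close>

lemma has_integral_powr_left_kernel:
  fixes c d \<alpha> :: real
  assumes "\<alpha> > 0" and "c \<le> d"
  shows "((\<lambda>t. (d - t) powr (\<alpha> - 1)) has_integral (d - c) powr \<alpha> / \<alpha>) {c..d}"
proof -
  have "((\<lambda>t. (d - t) powr (\<alpha> - 1)) has_integral
      (- ((d - d) powr \<alpha> / \<alpha>)) - (- ((d - c) powr \<alpha> / \<alpha>))) {c..d}"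
  proof (rule fundamental_theorem_of_calculus_interior[OF \<open>c \<le> d\<close>])
    show "continuous_on {c..d} (\<lambda>t. - ((d - t) powr \<alpha> / \<alpha>))"
      using assms by (intro continuous_intros continuous_on_powr') auto
    show "((\<lambda>t. - ((d - t) powr \<alpha> / \<alpha>)) has_vector_derivative (d - t) powr (\<alpha> - 1)) (at t)"
      if "t \<in> {c<..<d}" for t
      unfolding has_real_derivative_iff_has_vector_derivative[symmetric]
      using that assms by (auto intro!: derivative_eq_intros)
  qed
  then show ?thesis by simp
qed

lemma has_integral_powr_right_kernel:
  fixes c d \<alpha> :: real
  assumes "\<alpha> > 0" and "c \<le> d"
  shows "((\<lambda>t. (t - c) powr (\<alpha> - 1)) has_integral (d - c) powr \<alpha> / \<alpha>) {c..d}"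
proof -
  have "((\<lambda>t. (t - c) powr (\<alpha> - 1)) has_integral
      (d - c) powr \<alpha> / \<alpha> - (c - c) powr \<alpha> / \<alpha>) {c..d}"
  proof (rule fundamental_theorem_of_calculus_interior[OF \<open>c \<le> d\<close>])
    show "continuous_on {c..d} (\<lambda>t. (t - c) powr \<alpha> / \<alpha>)"
      using assms by (intro continuous_intros continuous_on_powr') auto
    show "((\<lambda>t. (t - c) powr \<alpha> / \<alpha>) has_vector_derivative (t - c) powr (\<alpha> - 1)) (at t)"
      if "t \<in> {c<..<d}" for t
      unfolding has_real_derivative_iff_has_vector_derivative[symmetric]
      using that assms by (auto intro!: derivative_eq_intros)
  qed
  then show ?thesis by simp
qed

text \<open>If \<open>\<lambda>t. k t * f t\<close> is not integrable, its Lebesgue integral has the junk value \<open>0\<close>,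
  which the nonnegative bound still covers.\<close>

lemma set_integral_kernel_mult_le:
  fixes k f :: "real \<Rightarrow> real"
  assumes k: "(k has_integral I) S" and k_nonneg: "\<And>t. t \<in> S \<Longrightarrow> 0 \<le> k t"
    and f_le: "\<And>t. t \<in> S \<Longrightarrow> f t \<le> M" and "0 \<le> M"
  shows "(LINT t:S|lebesgue. k t * f t) \<le> M * I"
proof -
  \<comment> \<open>A nonnegative function with a gauge integral is absolutely integrable, so
    \<open>I\<close> is also the Lebesgue integral of \<open>k\<close>.\<close>
  have int: "set_integrable lebesgue S k"
    using k k_nonneg by (intro nonnegative_absolutely_integrable_1) auto
  have "(LINT t:S|lebesgue. k t * f t) \<le> (LINT t:S|lebesgue. M * k t)"
    unfolding set_lebesgue_integral_def
  proof (rule integral_mono')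
    show "integrable lebesgue (\<lambda>t. indicator S t *\<^sub>R (M * k t))"
      using set_integrable_mult_right[OF int, of M] by (simp add: set_integrable_def)
    show "indicator S t *\<^sub>R (k t * f t) \<le> indicator S t *\<^sub>R (M * k t)" for t
      using mult_left_mono[OF f_le k_nonneg, of t t]
      by (auto simp: indicator_def mult.commute)
    show "0 \<le> indicator S t *\<^sub>R (M * k t)" for t
      using k_nonneg \<open>0 \<le> M\<close> by (auto simp: indicator_def)
  qed
  also have "\<dots> = M * integral S k"
    using set_lebesgue_integral_eq_integral(2)[OF int] by simp
  finally show ?thesis
    using integral_unique[OF k] by simp
qed

lemma Gamma_plus1_real:
  fixes x :: real
  assumes "x > 0"
  shows "Gamma (x + 1) = x * Gamma x"
  using assms by (intro Gamma_plus1) (auto elim: nonpos_Ints_cases)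

text \<open>The kernel is a nonnegative weight of total mass
  \<open>(d - c) powr \<alpha> / \<alpha>\<close>, and \<open>\<alpha> * Gamma \<alpha>\<close> is
  \<open>Gamma (\<alpha> + 1)\<close>.\<close>

lemma RL_left_le:
  assumes "\<alpha> > 0" and "c \<le> d" and "\<And>t. t \<in> {c..d} \<Longrightarrow> f t \<le> M" and "0 \<le> M"
  shows "RL_left c \<alpha> f d \<le> M * (d - c) powr \<alpha> / Gamma (\<alpha> + 1)"
proof -
  have "RL_left c \<alpha> f d \<le> 1 / Gamma \<alpha> * (M * ((d - c) powr \<alpha> / \<alpha>))"
    unfolding RL_left_def using assms
    by (intro mult_left_mono set_integral_kernel_mult_le has_integral_powr_left_kernel)
      (auto simp: Gamma_real_nonneg)
  then show ?thesis
    using Gamma_plus1_real[OF \<open>\<alpha> > 0\<close>] by (simp add: mult.commute)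
qed

lemma RL_right_le:
  assumes "\<alpha> > 0" and "c \<le> d" and "\<And>t. t \<in> {c..d} \<Longrightarrow> f t \<le> M" and "0 \<le> M"
  shows "RL_right d \<alpha> f c \<le> M * (d - c) powr \<alpha> / Gamma (\<alpha> + 1)"
proof -
  have "RL_right d \<alpha> f c \<le> 1 / Gamma \<alpha> * (M * ((d - c) powr \<alpha> / \<alpha>))"
    unfolding RL_right_def using assms
    by (intro mult_left_mono set_integral_kernel_mult_le has_integral_powr_right_kernel)
      (auto simp: Gamma_real_nonneg)
  then show ?thesis
    using Gamma_plus1_real[OF \<open>\<alpha> > 0\<close>] by (simp add: mult.commute)
qed

lemma prequasiinvex_on_le_max_endpoints:
  assumes inv: "invex A \<eta>" and C: "condition_C A \<eta>" and ab: "a \<in> A" "b \<in> A"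
    and pos: "a < a + \<eta> b a" and f: "prequasiinvex_on {a..a + \<eta> b a} \<eta> f"
    and x: "x \<in> {a..a + \<eta> b a}"
  shows "f x \<le> max (f a) (f (a + \<eta> b a))"
proof -
  define p where "p = (x - a) / \<eta> b a"
  have p: "p \<in> {0..1}" "x = a + p * \<eta> b a"
    using x pos by (auto simp: p_def field_simps)
  have "\<eta> (a + \<eta> b a) a = \<eta> b a"
    using condition_C_diff[OF inv C ab(2,1), of 1 0] by simp
  \<comment> \<open>The pair is \<open>a\<close> and the right endpoint instead of \<open>a\<close>
    and \<open>b\<close>: the point \<open>b\<close> may lie outside the interval.\<close>
  moreover have "f (a + p * \<eta> (a + \<eta> b a) a) \<le> max (f a) (f (a + \<eta> b a))"
    using f p(1) pos unfolding prequasiinvex_on_def by auto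
  ultimately show ?thesis
    using p(2) by simp
qed

theorem theorem7:
  fixes A :: "real set" and \<eta> :: "real \<Rightarrow> real \<Rightarrow> real"
    and f :: "real \<Rightarrow> real" and a b \<alpha> :: real
  assumes "open A" and "invex A \<eta>"
    and "a \<in> A" and "b \<in> A" and "a < a + \<eta> b a"
    and "\<forall>x\<in>{a..a + \<eta> b a}. 0 < f x"
    and "prequasiinvex_on {a..a + \<eta> b a} \<eta> f"
    and "set_integrable lebesgue {a..a + \<eta> b a} f"
    and "condition_C A \<eta>"
    and "\<alpha> > 0"
  shows "Gamma (\<alpha> + 1) / (2 * \<eta> b a powr \<alpha>) *
           (RL_left a \<alpha> f (a + \<eta> b a) + RL_right (a + \<eta> b a) \<alpha> f a)
         \<le> max (f a) (f (a + \<eta> b a))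
       \<and> (\<forall>D. {a..a + \<eta> b a} \<subseteq> D \<and> D \<subseteq> A \<and> invex D \<eta> \<and> prequasiinvex_on D \<eta> f \<and> b \<in> D
              \<longrightarrow> max (f a) (f (a + \<eta> b a)) \<le> max (f a) (f b))"
proof (intro conjI allI impI)
  define e where "e = \<eta> b a"
  define M where "M = max (f a) (f (a + e))"
  have e: "e > 0" and le: "a \<le> a + e"
    using assms(5) by (simp_all add: e_def)
  have f_le: "f t \<le> M" if "t \<in> {a..a + e}" for t
    using prequasiinvex_on_le_max_endpoints[OF assms(2,9,3,4,5,7)] that
    by (simp add: M_def e_def)
  \<comment> \<open>Positivity of \<open>f\<close> at an endpoint supplies the sign condition of the
    integral bounds.\<close>
  have M: "0 \<le> M"
    using assms(5,6) by (auto simp: M_def intro: less_imp_le simp: le_max_iff_disj)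
  have "Gamma (\<alpha> + 1) / (2 * e powr \<alpha>) * (RL_left a \<alpha> f (a + e) + RL_right (a + e) \<alpha> f a)
      \<le> Gamma (\<alpha> + 1) / (2 * e powr \<alpha>) *
        (M * e powr \<alpha> / Gamma (\<alpha> + 1) + M * e powr \<alpha> / Gamma (\<alpha> + 1))"
    using RL_left_le[OF assms(10) le f_le M] RL_right_le[OF assms(10) le f_le M] assms(10)
    by (intro mult_left_mono add_mono) (auto simp: Gamma_real_nonneg)
  \<comment> \<open>The two integrals have the same bound, and the 2 in the prefactor averages
    them.\<close>
  also have "\<dots> = M"
  proof -
    have "Gamma (\<alpha> + 1) > 0"
      using assms(10) by (simp add: Gamma_real_pos)
    then show ?thesis
      using e by (simp add: field_simps)
  qed
  finally show "Gamma (\<alpha> + 1) / (2 * \<eta> b a powr \<alpha>) *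
      (RL_left a \<alpha> f (a + \<eta> b a) + RL_right (a + \<eta> b a) \<alpha> f a)
      \<le> max (f a) (f (a + \<eta> b a))"
    by (simp add: M_def e_def)
next
  \<comment> \<open>\<open>D\<close> is a domain of \<open>f\<close> that reaches \<open>b\<close>;
    the interval alone need not, and then \<open>f b\<close> would carry no information.\<close>
  fix D
  assume D: "{a..a + \<eta> b a} \<subseteq> D \<and> D \<subseteq> A \<and> invex D \<eta> \<and> prequasiinvex_on D \<eta> f \<and> b \<in> D"
  then have "a \<in> D" "b \<in> D"
    using assms(5) by auto
  \<comment> \<open>The right endpoint is the point t = 1 on the path from \<open>a\<close> given by
    \<open>\<eta> b a\<close>; the factor 1 is written out to match the definition.\<close>
  then have "f (a + 1 * \<eta> b a) \<le> max (f a) (f b)"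
    using D unfolding prequasiinvex_on_def by (meson atLeastAtMost_iff order_refl zero_le_one)
  then show "max (f a) (f (a + \<eta> b a)) \<le> max (f a) (f b)"
    by simp
qed

end
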